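(* Let $S = \langle g_1, \ldots, g_k\rangle$ be a numerical semigroup and let $g = g_1 + \cdots + g_k$. Write $\operatorname{Ap}(S; g_1) = \{a_0, a_1, \ldots, a_{g_1 - 1}\}$ where each $a_j \equiv j \bmod g_1$. For all $n \in S$ with $n > g_1^2 g$ and $n \equiv i \bmod g_1$ (with $i \in \{0, 1, \ldots, g_1 - 1\}$), we have \[ \ell_\infty^M(n) = \tfrac{1}{g_1}(n - a_i). \] In particular, for all $n > g_1^2 g$, we have \[ \ell_\infty^M(n) = \ell_\infty^M(n - g_1) + 1. \]
   Context: A numerical semigroup $S$ is an additive submonoid of $\mathbb{Z}_{\ge 0}$ with finite complement. Writing $S = \langle g_1, \ldots, g_k\rangle = \{z_1 g_1 + \cdots + z_k g_k : z_1, \ldots, z_k \in \mathbb{Z}_{\ge 0}\}$ means that $g_1 < g_2 < \cdots < g_k$ are the atoms (irreducible elements, i.e. minimal generators) of $S$. For $n \in S$, the set of factorizations of $n$ is $\mathsf{Z}(n) = \{\mathbf{z} \in \mathbb{Z}_{\ge 0}^k : n = z_1 g_1 + \cdots + z_k g_k\}$. For $\mathbf{z} \in \mathbb{Z}^k$, let $\ell_\infty(\mathbf{z}) = \max\{z_1, \ldots, z_k\}$, and for $n \in S$ let $\ell_\infty^M(n) = \max\{\ell_\infty(\mathbf{z}) : \mathbf{z} \in \mathsf{Z}(n)\}$. For a positive $m \in S$, the Apéry set of $S$ with respect to $m$ is $\operatorname{Ap}(S; m) = \{s \in S : s - m \notin S\}$. It consists of the smallest element of $S$ in each congruence class modulo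 $m$, so it has exactly one element in each class modulo $m$. *)

theory Defs
  imports Complex_Main "HOL-Number_Theory.Cong"
begin

definition numerical_semigroup :: "nat set \<Rightarrow> bool" where
  "numerical_semigroup S \<longleftrightarrow>
     0 \<in> S \<and> (\<forall>x\<in>S. \<forall>y\<in>S. x + y \<in> S) \<and> finite (UNIV - S)"

definition atoms :: "nat set \<Rightarrow> nat set" where
  "atoms S = {s \<in> S. s \<noteq> 0 \<and> (\<forall>x\<in>S. \<forall>y\<in>S. s = x + y \<longrightarrow> x = 0 \<or> y = 0)}"

text \<open>Tuples are lists indexed from 0: the generators \<open>g\<^sub>1, \<dots>, g\<^sub>k\<close>
  are \<open>gs ! 0, \<dots>, gs ! (k - 1)\<close> with \<open>k = length gs\<close>.\<close>

definition factorizations :: "nat list \<Rightarrow> nat \<Rightarrow> nat list set" where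
  "factorizations gs n =
     {z. length z = length gs \<and> n = (\<Sum>i<length gs. z ! i * gs ! i)}"

definition generated :: "nat list \<Rightarrow> nat set" where
  "generated gs =
     {(\<Sum>i<length gs. z ! i * gs ! i) | z :: nat list. length z = length gs}"

text \<open>The convention behind writing \<open>S = \<langle>g\<^sub>1, \<dots>, g\<^sub>k\<rangle>\<close>: the generators
  are precisely the atoms of \<open>S\<close>, in increasing order.\<close>

definition minimally_generated :: "nat set \<Rightarrow> nat list \<Rightarrow> bool" where
  "minimally_generated S gs \<longleftrightarrow>
     S = generated gs \<and> sorted_wrt (<) gs \<and> set gs = atoms S"

text \<open>The maximum of the entries themselves, without absolute values.\<close>

definition linf :: "'a::linorder list \<Rightarrow> 'a" where
  "linf z = Max (set z)"

text \<open>Meaningful when \<open>n\<close> has a factorization; the set of factorizations is finite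
  if all generators are positive.\<close>

definition linf_max :: "nat list \<Rightarrow> nat \<Rightarrow> nat" where
  "linf_max gs n = Max (linf ` factorizations gs n)"

text \<open>The difference is taken in the integers, so that \<open>s - m \<notin> S\<close> holds for \<open>s < m\<close>.\<close>

definition Apery :: "nat set \<Rightarrow> nat \<Rightarrow> nat set" where
  "Apery S m = {s \<in> S. int s - int m \<notin> int ` S}"

end

theory Submission
  imports Defs
begin

text \<open>
  Every coordinate of a factorization of an Apery element is less than \<open>g\<^sub>1\<close>, as \<open>g\<^sub>1\<close> copies of
  \<open>g\<^sub>j\<close> could be traded for \<open>g\<^sub>j\<close> copies of \<open>g\<^sub>1\<close>; so \<open>a\<^sub>i \<le> (g\<^sub>1 - 1) g\<close> and
  \<open>(g\<^sub>1 + 1) a\<^sub>i \<le> (g\<^sub>1\<^sup>2 - 1) g\<close>. For \<open>n \<equiv> i\<close>, the largest possible first coordinate is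
  \<open>(n - a\<^sub>i) / g\<^sub>1\<close>, by minimality of \<open>a\<^sub>i\<close> in its class, while the other coordinates are at most
  \<open>n / (g\<^sub>1 + 1)\<close>. The first bound is the larger one as soon as \<open>n \<ge> (g\<^sub>1 + 1) a\<^sub>i\<close>, and this
  holds for \<open>n > g\<^sub>1\<^sup>2 g - g\<^sub>1\<close>, hence for both \<open>n\<close> and \<open>n - g\<^sub>1\<close> in the recursion.
\<close>

lemma numerical_semigroup_mult_mem:
  assumes "numerical_semigroup S" "x \<in> S"
  shows "c * x \<in> S"
  using assms by (induction c) (auto simp: numerical_semigroup_def)

lemma numerical_semigroup_sum_mem:
  assumes "numerical_semigroup S" "\<And>i. i \<in> A \<Longrightarrow> f i \<in> S"
  shows "sum f A \<in> S"
  using assms(2)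
  by (induction A rule: infinite_finite_induct)
     (use assms(1) in \<open>auto simp: numerical_semigroup_def\<close>)

lemma numerical_semigroup_ne_zero:
  assumes "numerical_semigroup S"
  shows "S \<noteq> {0}"
proof
  assume "S = {0}"
  then have "finite (UNIV :: nat set)"
    using assms unfolding numerical_semigroup_def by (metis finite.emptyI finite_Diff2 finite_insert)
  then show False by simp
qed

lemma minimally_generated_nth:
  assumes "minimally_generated S gs" "i < length gs"
  shows "gs ! i \<in> S" "gs ! i > 0"
proof -
  have "gs ! i \<in> atoms S"
    using assms by (metis minimally_generated_def nth_mem)
  then show "gs ! i \<in> S" "gs ! i > 0" by (auto simp: atoms_def)
qed

lemma mem_iff_factorizations:
  assumes "minimally_generated S gs"
  shows "n \<in> S \<longleftrightarrow> factorizations gs n \<noteq> {}"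
  using assms unfolding minimally_generated_def generated_def factorizations_def by blast

text \<open>An empty list generates only 0, whose complement is infinite. This makes
  \<open>gs ! 0\<close> a genuine generator and \<open>Max (set z)\<close> a maximum over a nonempty
  set.\<close>

lemma minimally_generated_nonempty:
  assumes "numerical_semigroup S" "minimally_generated S gs"
  shows "gs \<noteq> []"
proof
  assume "gs = []"
  then have "S = {0}"
    using assms(2) by (auto simp: minimally_generated_def generated_def)
  then show False using numerical_semigroup_ne_zero[OF assms(1)] by blast
qed

lemma factorization_nth_mult_le:
  assumes "z \<in> factorizations gs n" "i < length gs"
  shows "z ! i * gs ! i \<le> n"
  using assms member_le_sum[of i "{..<length gs}" "\<lambda>i. z ! i * gs ! i"]
  by (auto simp: factorizations_def)

text \<open>Dropping all copies of one generator leaves a combination of the others. The subtraction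
  never truncates, since the dropped part is a summand of \<open>n\<close>.\<close>

lemma factorization_diff_mem:
  assumes "numerical_semigroup S" "minimally_generated S gs"
    and "z \<in> factorizations gs n" "i < length gs"
  shows "n - z ! i * gs ! i \<in> S"
proof -
  have "n = z ! i * gs ! i + (\<Sum>j\<in>{..<length gs} - {i}. z ! j * gs ! j)"
    using assms(3,4) sum.remove[of "{..<length gs}" i "\<lambda>j. z ! j * gs ! j"]
    by (auto simp: factorizations_def)
  moreover have "(\<Sum>j\<in>{..<length gs} - {i}. z ! j * gs ! j) \<in> S"
    by (intro numerical_semigroup_sum_mem numerical_semigroup_mult_mem assms(1))
       (use minimally_generated_nth(1)[OF assms(2)] in auto)
  ultimately show ?thesis by simp
qed

lemma finite_factorizations:
  assumes "\<And>i. i < length gs \<Longrightarrow> gs ! i > 0"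
  shows "finite (factorizations gs n)"
proof (rule finite_subset)
  show "factorizations gs n \<subseteq> {z. set z \<subseteq> {..n} \<and> length z = length gs}"
  proof (rule subsetI, rule CollectI, rule conjI)
    fix z assume z: "z \<in> factorizations gs n"
    then show len: "length z = length gs" by (simp add: factorizations_def)
    show "set z \<subseteq> {..n}"
    proof
      fix x assume "x \<in> set z"
      then obtain i where i: "i < length gs" "x = z ! i"
        using len by (metis in_set_conv_nth)
      have "x * 1 \<le> x * gs ! i" using assms[OF i(1)] by (intro mult_le_mono) auto
      also have "\<dots> \<le> n" using factorization_nth_mult_le[OF z i(1)] i(2) by simp
      finally show "x \<in> {..n}" by simp
    qed
  qed
  show "finite {z. set z \<subseteq> {..n} \<and> length z = length gs}"
    by (rule finite_lists_length_eq) simp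
qed

text \<open>Writing the element as \<open>s + m\<close> trades the integer difference in
  \<open>Apery\<close> for natural numbers.\<close>

lemma Apery_add_not_mem:
  assumes "s + m \<in> Apery S m"
  shows "s \<notin> S"
  using assms by (auto simp: Apery_def)

text \<open>If \<open>x < w\<close>, then \<open>w - m\<close> is \<open>x\<close> plus a multiple
  of \<open>m\<close>, hence in \<open>S\<close>, contradicting
  \<open>w \<in> Apery S m\<close>.\<close>

lemma Apery_le:
  assumes "numerical_semigroup S" "m \<in> S" "w \<in> Apery S m" "x \<in> S" "[x = w] (mod m)"
  shows "w \<le> x"
proof (rule ccontr)
  assume "\<not> w \<le> x"
  then have "x < w" by simp
  then obtain t where t: "w = x + m * t"
    using assms(5) by (metis cong_iff_lin_nat less_imp_le_nat nat_less_le cong_sym cong_le_nat mult.commute add.commute)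
  then obtain u where "t = Suc u" using \<open>x < w\<close> by (cases t) auto
  then have "w = (x + u * m) + m" using t by (simp add: algebra_simps)
  moreover have "x + u * m \<in> S"
    using assms(1,4) numerical_semigroup_mult_mem[OF assms(1,2)]
    by (auto simp: numerical_semigroup_def)
  ultimately show False using Apery_add_not_mem assms(3) by metis
qed

lemma Apery_factorization_nth_less:
  assumes S: "numerical_semigroup S" "minimally_generated S gs"
    and m: "m \<in> S" "w \<in> Apery S m"
    and z: "z \<in> factorizations gs w" "i < length gs"
  shows "z ! i < m"
proof (rule ccontr)
  define r where "r = w - z ! i * gs ! i"
  define b where "b = gs ! i - 1"
  have b: "gs ! i = Suc b"
    using minimally_generated_nth(2)[OF S(2) z(2)] by (simp add: b_def)
  assume "\<not> z ! i < m"
  then obtain c where c: "z ! i = m + c" by (metis le_Suc_ex not_less)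
  have "w = r + z ! i * gs ! i"
    using factorization_nth_mult_le[OF z] by (simp add: r_def)
  \<comment> \<open>The \<open>m\<close> copies of \<open>gs ! i = Suc b\<close> are worth
    \<open>Suc b\<close> copies of \<open>m\<close>; one is split off and \<open>b\<close>
    remain.\<close>
  then have "w = (r + (c * gs ! i + b * m)) + m"
    by (simp add: c b algebra_simps)
  moreover have "r + (c * gs ! i + b * m) \<in> S"
    using factorization_diff_mem[OF S z] S(1) m(1)
      numerical_semigroup_mult_mem[OF S(1) m(1)]
      numerical_semigroup_mult_mem[OF S(1) minimally_generated_nth(1)[OF S(2) z(2)]]
    unfolding r_def numerical_semigroup_def by blast
  ultimately show False using Apery_add_not_mem m(2) by metis
qed

lemma Apery_bound:
  assumes S: "numerical_semigroup S" "minimally_generated S gs"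
    and m: "m \<in> S" "w \<in> Apery S m"
  shows "w \<le> (m - 1) * sum_list gs"
proof -
  obtain z where z: "z \<in> factorizations gs w"
    using mem_iff_factorizations[OF S(2)] m(2) by (auto simp: Apery_def)
  have "w = (\<Sum>i<length gs. z ! i * gs ! i)"
    using z by (simp add: factorizations_def)
  also have "\<dots> \<le> (\<Sum>i<length gs. (m - 1) * gs ! i)"
    by (intro sum_mono mult_le_mono order_refl)
       (use Apery_factorization_nth_less[OF S m z] in fastforce)
  also have "\<dots> = (m - 1) * sum_list gs"
    by (simp add: sum_list_sum_nth atLeast0LessThan sum_distrib_left)
  finally show ?thesis .
qed

text \<open>The additive form avoids division and truncated subtraction. Both bounds on coordinates
  are compared with \<open>q = (n - w) / gs ! 0\<close>.\<close>

lemma linf_max_eq: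
  assumes S: "numerical_semigroup S" "minimally_generated S gs"
    and w: "w \<in> Apery S (gs ! 0)" "[n = w] (mod (gs ! 0))"
    and large: "(gs ! 0 + 1) * w \<le> n"
  shows "n = w + linf_max gs n * gs ! 0"
proof -
  have len: "0 < length gs" using minimally_generated_nonempty[OF S] by simp
  note g0 = minimally_generated_nth[OF S(2) len]
  have "w \<le> n" using large by simp
  then obtain q where q: "n = w + q * gs ! 0"
    using w(2) by (metis cong_le_nat cong_sym mult.commute add.commute)
  have coord: "z ! i \<le> q" if z: "z \<in> factorizations gs n" and i: "i < length gs" for z i
  proof (cases "i = 0")
    case True
    let ?x = "n - z ! 0 * gs ! 0"
    have le: "z ! 0 * gs ! 0 \<le> n" using factorization_nth_mult_le[OF z len] .
    \<comment> \<open>What remains without the first generator lies in \<open>S\<close> and in the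
      class of \<open>w\<close>, so minimality of \<open>w\<close> applies.\<close>
    have "[?x + z ! 0 * gs ! 0 = w] (mod gs ! 0)" using le w(2) by simp
    then have "[?x = w] (mod gs ! 0)" by (simp add: cong_def)
    then have "w \<le> ?x"
      using Apery_le[OF S(1) g0(1) w(1) factorization_diff_mem[OF S z len]] by blast
    then have "z ! 0 * gs ! 0 \<le> q * gs ! 0" using q le by linarith
    then show ?thesis using g0(2) True by simp
  next
    case False
    then have "gs ! 0 < gs ! i"
      using S(2) i by (auto simp: minimally_generated_def sorted_wrt_iff_nth_less)
    then have "z ! i * (gs ! 0 + 1) \<le> z ! i * gs ! i" by (intro mult_le_mono) auto
    also have "\<dots> \<le> n" by (rule factorization_nth_mult_le[OF z i])
    \<comment> \<open>Here \<open>large\<close> enters: after substituting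
      \<open>n = w + q * gs ! 0\<close> it says exactly \<open>w \<le> q\<close>.\<close>
    also have "n \<le> q * (gs ! 0 + 1)"
    proof -
      have "w * gs ! 0 \<le> q * gs ! 0" using large q by (simp add: algebra_simps)
      then have "w \<le> q" using g0(2) by simp
      then show ?thesis using q by simp
    qed
    finally show ?thesis by (simp only: mult_le_cancel2)
  qed
  have bound: "linf z \<le> q" if z: "z \<in> factorizations gs n" for z
  proof -
    have "length z = length gs" using z by (simp add: factorizations_def)
    then show ?thesis
      unfolding linf_def using coord[OF z] len by (subst Max_le_iff) (auto simp: in_set_conv_nth)
  qed
  obtain v where v: "v \<in> factorizations gs w"
    using mem_iff_factorizations[OF S(2)] w(1) by (auto simp: Apery_def)
  \<comment> \<open>The bound \<open>q\<close> is attained by adding \<open>q\<close> copies of the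
    first generator to any factorization of \<open>w\<close>.\<close>
  define z where "z = v[0 := v ! 0 + q]"
  have lenv: "length v = length gs" and sumv: "w = (\<Sum>i<length gs. v ! i * gs ! i)"
    using v by (auto simp: factorizations_def)
  have "(\<Sum>i<length gs. z ! i * gs ! i)
      = (\<Sum>i<length gs. v ! i * gs ! i + (if i = 0 then q * gs ! 0 else 0))"
    by (intro sum.cong) (auto simp: z_def nth_list_update lenv algebra_simps)
  also have "\<dots> = n" using len q sumv by (simp add: sum.distrib)
  finally have z: "z \<in> factorizations gs n" by (simp add: factorizations_def z_def lenv)
  have "z ! 0 \<le> linf z"
    unfolding linf_def using len lenv by (intro Max_ge nth_mem) (auto simp: z_def)
  then have "q \<le> linf z" using len lenv by (simp add: z_def)
  then have "linf z = q" using bound[OF z] by simp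
  then have "linf_max gs n = q"
    unfolding linf_max_def
    using z bound finite_factorizations[OF minimally_generated_nth(2)[OF S(2)]]
    by (intro Max_eqI) auto
  then show ?thesis using q by simp
qed

theorem theorem2p4:
  fixes S :: "nat set" and gs :: "nat list" and a :: "nat \<Rightarrow> nat" and g1 g :: nat
  assumes "numerical_semigroup S"
    and "minimally_generated S gs"
    and "g1 = gs ! 0"
    and "g = sum_list gs"
    and "Apery S g1 = a ` {..<g1}"
    and "\<forall>j<g1. [a j = j] (mod g1)"
  shows "(\<forall>n\<in>S. \<forall>i<g1. n > g1\<^sup>2 * g \<and> [n = i] (mod g1) \<longrightarrow>
            real (linf_max gs n) = 1 / real g1 * (real n - real (a i))) \<and>
         (\<forall>n. n > g1\<^sup>2 * g \<longrightarrow> linf_max gs n = linf_max gs (n - g1) + 1)"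
proof -
  note S = assms(1,2)
  have len: "0 < length gs" using minimally_generated_nonempty[OF S] by simp
  have g1: "g1 \<in> S" "g1 > 0"
    using minimally_generated_nth[OF S(2) len] assms(3) by auto
  have "g1 \<le> g" using assms(3,4) len by (simp add: member_le_sum_list)
  \<comment> \<open>The extra summand \<open>g1\<close> leaves room to descend from \<open>n\<close>
    to \<open>n - g1\<close>.\<close>
  have small: "(g1 + 1) * a i + g1 \<le> g1\<^sup>2 * g" if i: "i < g1" for i
  proof -
    obtain b where b: "g1 = Suc b" using g1(2) by (cases g1) auto
    have "a i \<le> b * g"
      using Apery_bound[OF S g1(1), of "a i"] assms(4,5) i b by auto
    then have "(g1 + 1) * a i + g1 \<le> (g1 + 1) * (b * g) + g"
      using \<open>g1 \<le> g\<close> by (intro add_mono mult_le_mono) auto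
    \<comment> \<open>With \<open>g1 = b + 1\<close> this is
      \<open>(b + 2) * b + 1 = (b + 1)\<^sup>2\<close>, times \<open>g\<close>.\<close>
    also have "\<dots> = g1\<^sup>2 * g" by (simp add: b power2_eq_square algebra_simps)
    finally show ?thesis .
  qed
  have key: "n = a i + linf_max gs n * g1"
    if "i < g1" "[n = i] (mod g1)" "g1\<^sup>2 * g \<le> n + g1" for n i
  proof -
    have "[n = a i] (mod g1)" using that assms(6) by (metis cong_sym cong_trans)
    moreover have "a i \<in> Apery S g1" using assms(5) that(1) by blast
    moreover have "(g1 + 1) * a i \<le> n" using small[OF that(1)] that(3) by linarith
    ultimately show ?thesis using linf_max_eq[OF S, of "a i" n] assms(3) by simp
  qed
  show ?thesis
  proof (intro conjI ballI allI impI)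
    fix n i assume "i < g1" "g1\<^sup>2 * g < n \<and> [n = i] (mod g1)"
    then have "n = a i + linf_max gs n * g1" using key[of i n] by auto
    then have "real n = real (a i) + real (linf_max gs n) * real g1"
      by (metis of_nat_add of_nat_mult)
    then show "real (linf_max gs n) = 1 / real g1 * (real n - real (a i))"
      using g1(2) by (simp add: field_simps)
  next
    fix n assume n: "g1\<^sup>2 * g < n"
    define i where "i = n mod g1"
    have i: "i < g1" "[n = i] (mod g1)" using g1(2) by (auto simp: i_def cong_def)
    \<comment> \<open>Thus \<open>n - g1\<close> is a true difference in the same class, and both
      values are measured from the same \<open>a i\<close>.\<close>
    have "g1 \<le> n" using small[OF i(1)] n by linarith
    then have "[n - g1 = i] (mod g1)" using i(2) by (simp add: cong_def le_mod_geq)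
    then have "n - g1 = a i + linf_max gs (n - g1) * g1"
      using key[of i "n - g1"] i(1) n \<open>g1 \<le> n\<close> by simp
    moreover have "n = a i + linf_max gs n * g1" using key[of i n] i n by simp
    ultimately have "linf_max gs n * g1 = (linf_max gs (n - g1) + 1) * g1"
      using \<open>g1 \<le> n\<close> by (simp add: algebra_simps)
    then show "linf_max gs n = linf_max gs (n - g1) + 1"
      using g1(2) by (metis mult_cancel2 less_irrefl)
  qed
qed

end
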